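(* Let $n\ge 3$. For every $\xi\in\mathcal{C}(\mathcal{G}_n)$, the number $lg(n;\xi)$ of labelled graphs $G$ of order $n$ with $|\Gamma(G)|=\xi$ satisfies $$lg(n;\xi)=|\mathcal{L}_\xi(\mathcal{G}_n)|.$$
   Context: Let $V=\{1,\dots,n\}$ and let $\binom{V}{2}$ be the set of 2-element subsets of $V$; write $ij$ for $\{i,j\}$ with $i<j$. A labelled graph of order $n$ is a pair $G=(V,E)$ with $E\subseteq\binom{V}{2}$; $\mathcal{G}_n$ is the set of all of them. Let $A$ be the symmetric group on $V$. For $\alpha\in A$, $\alpha G$ is the graph on $V$ with edge-set $\{\{\alpha i,\alpha j\}: ij\in E\}$; $\Gamma(G)=\{\alpha\in A:\alpha G=G\}$ is the automorphism group of $G$. Let $\alpha'$ be the permutation of $\binom{V}{2}$ given by $\alpha'\{i,j\}=\{\alpha i,\alpha j\}$, and let $Z(\alpha')$ be the set of all cycles (including cycles of length 1) in the disjoint cycle decomposition of $\alpha'$. Let $\lambda=\binom{n}{2}$, and for $ij\in\binom{V}{2}$ ($i<j$) let $p_{ij}=\frac{(2n-i)(i-1)}{2}+(j-i)$ and $w(ij)=2^{\lambda-p_{ij}}$. For a cycle $z$ let $W(z)=\sum_{ij\in z}w(ij)$, and define the polynomials $$F_\alpha^{(n)}(x)=\prod_{z\in Z(\alpha')}\bigl(1+x^{W(z)}\bigr)\ (\alpha\in A),\qquad F^{(n)}(x)=\sum_{\alpha\in A}F_\alpha^{(n)}(x).$$ Let $c_L$ be the coefficient of $x^L$ in $F^{(n)}(x)$.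 Put $\mathcal{C}(\mathcal{G}_n)=\{c_L : L\ge 0,\ c_L\neq 0\}$ (the set of coefficients of terms occurring in $F^{(n)}(x)$), and for a positive integer $\xi$ put $\mathcal{L}_\xi(\mathcal{G}_n)=\{L : c_L=\xi\}$. *)

theory Defs
  imports "HOL-Combinatorics.Permutations" "HOL-Combinatorics.Orbits"
    "HOL-Computational_Algebra.Polynomial"
begin

definition vertices :: "nat \<Rightarrow> nat set" where
  "vertices n = {1..n}"

definition pairs :: "nat \<Rightarrow> nat set set" where
  "pairs n = {e. e \<subseteq> vertices n \<and> card e = 2}"

type_synonym lgraph = "nat set \<times> nat set set"

definition labelled_graphs :: "nat \<Rightarrow> lgraph set" where
  "labelled_graphs n = {(V, E). V = vertices n \<and> E \<subseteq> pairs n}"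

definition act :: "(nat \<Rightarrow> nat) \<Rightarrow> lgraph \<Rightarrow> lgraph" where
  "act \<alpha> G = (fst G, {{\<alpha> i, \<alpha> j} | i j. {i, j} \<in> snd G})"

definition Aut :: "lgraph \<Rightarrow> (nat \<Rightarrow> nat) set" where
  "Aut G = {\<alpha>. \<alpha> permutes fst G \<and> act \<alpha> G = G}"

definition lg :: "nat \<Rightarrow> nat \<Rightarrow> nat" where
  "lg n \<xi> = card {G \<in> labelled_graphs n. card (Aut G) = \<xi>}"

text \<open>The permutation of the pairs induced by a permutation of the vertices, extended by
  the identity to all sets, as is the convention for \<^const>\<open>permutes\<close>.\<close>

definition pair_perm :: "nat \<Rightarrow> (nat \<Rightarrow> nat) \<Rightarrow> nat set \<Rightarrow> nat set" where
  "pair_perm n \<alpha> e = (if e \<in> pairs n then \<alpha> ` e else e)"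

text \<open>A cycle of the disjoint cycle decomposition is identified with the set of the elements
  it moves cyclically; fixed pairs give the singleton cycles.\<close>

definition pair_cycles :: "nat \<Rightarrow> (nat \<Rightarrow> nat) \<Rightarrow> nat set set set" where
  "pair_cycles n \<alpha> = {z. z \<subseteq> pairs n \<and> cyclic_on (pair_perm n \<alpha>) z}"

text \<open>For \<open>1 \<le> i < j \<le> n\<close> the division is exact, no subtraction truncates, and
  \<open>position n i j\<close> is the place of \<open>{i, j}\<close>, from \<open>1\<close> to \<open>n choose 2\<close>, in the lexicographic
  enumeration of the pairs.\<close>

definition position :: "nat \<Rightarrow> nat \<Rightarrow> nat \<Rightarrow> nat" where
  "position n i j = (2 * n - i) * (i - 1) div 2 + (j - i)"

definition weight :: "nat \<Rightarrow> nat set \<Rightarrow> nat" where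
  "weight n e = 2 ^ ((n choose 2) - position n (Min e) (Max e))"

definition cycle_weight :: "nat \<Rightarrow> nat set set \<Rightarrow> nat" where
  "cycle_weight n z = (\<Sum>e\<in>z. weight n e)"

definition F_perm :: "nat \<Rightarrow> (nat \<Rightarrow> nat) \<Rightarrow> nat poly" where
  "F_perm n \<alpha> = (\<Prod>z\<in>pair_cycles n \<alpha>. 1 + monom 1 (cycle_weight n z))"

definition F_poly :: "nat \<Rightarrow> nat poly" where
  "F_poly n = (\<Sum>\<alpha> | \<alpha> permutes vertices n. F_perm n \<alpha>)"

definition coeff_set :: "nat \<Rightarrow> nat set" where
  "coeff_set n = {coeff (F_poly n) L | L. coeff (F_poly n) L \<noteq> 0}"

definition level_set :: "nat \<Rightarrow> nat \<Rightarrow> nat set" where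
  "level_set n \<xi> = {L. coeff (F_poly n) L = \<xi>}"

end

theory Submission
  imports Defs "HOL-Library.Nat_Bijection"
begin

text \<open>Expanding the product over the cycles of \<open>\<alpha>'\<close> yields one term for each set of cycles,
  and the unions of sets of cycles are exactly the edge sets preserved by \<open>\<alpha>\<close>. Summing over
  \<open>\<alpha>\<close>, an edge set \<open>E\<close> contributes a monomial with coefficient \<open>|\<Gamma>(V, E)|\<close> whose exponent is the
  total weight of \<open>E\<close>. The weights are distinct powers of two, so distinct edge sets have distinct total weights and no
  two terms are merged.\<close>

section \<open>Invariant sets as unions of cycles\<close>

lemma bij_betw_Union_cyclic_sets:
  assumes "f permutes P" "finite P"
  shows "bij_betw \<Union> (Pow {z. z \<subseteq> P \<and> cyclic_on f z}) {E. E \<subseteq> P \<and> f ` E = E}"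
\<comment> \<open>The inverse splits an invariant set into the orbits of its elements; each orbit is
  a cyclic set because \<open>P\<close> is finite.\<close>
proof (rule bij_betw_byWitness[where f' = "\<lambda>E. orbit f ` E"])
  have perm: "permutation f"
    using assms permutation_permutes by blast
  have orbit_eq: "orbit f x = z" if "cyclic_on f z" "x \<in> z" for x z
    using that by (rule orbit_cyclic_eq3)
  show "\<forall>S \<in> Pow {z. z \<subseteq> P \<and> cyclic_on f z}. orbit f ` \<Union> S = S"
  proof
    fix S assume S: "S \<in> Pow {z. z \<subseteq> P \<and> cyclic_on f z}"
    have "z \<in> orbit f ` \<Union> S" if "z \<in> S" for z
    proof -
      have "cyclic_on f z" using S that by blast
      then obtain x where "x \<in> z" "z = orbit f x" unfolding cyclic_on_def by blast
      with that show ?thesis by blast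
    qed
    moreover have "orbit f x \<in> S" if "x \<in> z" "z \<in> S" for x z
      using S that orbit_eq by blast
    ultimately show "orbit f ` \<Union> S = S" by blast
  qed
  have orbit_subset_inv: "orbit f x \<subseteq> E" if "f ` E = E" "x \<in> E" for x E
  proof
    fix y assume "y \<in> orbit f x"
    then show "y \<in> E" by induct (use that in blast)+
  qed
  \<comment> \<open>\<open>orbit f x\<close> is generated from \<open>f x\<close>; that
    \<open>x\<close> itself belongs to it relies on \<open>f\<close> being a permutation of finite
    support.\<close>
  show "\<forall>E \<in> {E. E \<subseteq> P \<and> f ` E = E}. \<Union> (orbit f ` E) = E"
    using orbit_subset_inv permutation_self_in_orbit[OF perm] by blast
  show "\<Union> ` Pow {z. z \<subseteq> P \<and> cyclic_on f z} \<subseteq> {E. E \<subseteq> P \<and> f ` E = E}"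
  proof clarify
    fix S assume S: "S \<subseteq> {z. z \<subseteq> P \<and> cyclic_on f z}"
    then have sub: "\<Union> S \<subseteq> P" by blast
    have "f ` \<Union> S \<subseteq> \<Union> S"
      using S cyclic_on_inI by fastforce
    moreover have "finite (\<Union> S)"
      using sub assms(2) by (rule finite_subset)
    moreover have "inj_on f (\<Union> S)"
      using assms(1) permutes_inj_on by blast
    ultimately have "f ` \<Union> S = \<Union> S"
      by (simp add: endo_inj_surj)
    with sub show "\<Union> S \<subseteq> P \<and> f ` \<Union> S = \<Union> S" ..
  qed
  show "(\<lambda>E. orbit f ` E) ` {E. E \<subseteq> P \<and> f ` E = E} \<subseteq> Pow {z. z \<subseteq> P \<and> cyclic_on f z}"
    using orbit_subset_inv cyclic_on_orbit[OF assms] by blast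
qed

text \<open>A cyclic set is the orbit of each of its elements, so one common element forces
  equality.\<close>

lemma cyclic_on_disjoint:
  assumes "cyclic_on f y" "cyclic_on f z" "y \<noteq> z"
  shows "y \<inter> z = {}"
  using assms by (metis disjoint_iff orbit_cyclic_eq3)

section \<open>The polynomials as sums over edge sets\<close>

lemma prod_monom_1:
  "(\<Prod>z\<in>A. monom (1::'b::comm_semiring_1) (g z)) = monom 1 (\<Sum>z\<in>A. g z)"
  by (induct A rule: infinite_finite_induct) (simp_all add: mult_monom)

lemma finite_pairs: "finite (pairs n)"
  by (rule finite_subset[of _ "Pow {1..n}"]) (auto simp: pairs_def vertices_def)

lemma pair_perm_permutes:
  assumes "\<alpha> permutes vertices n"
  shows "pair_perm n \<alpha> permutes pairs n"
proof (rule bij_imp_permutes)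
  have inj: "inj \<alpha>" using assms by (rule permutes_inj)
  have "pair_perm n \<alpha> ` pairs n \<subseteq> pairs n"
  proof clarify
    fix e assume "e \<in> pairs n"
    then have "\<alpha> ` e \<subseteq> vertices n" "card (\<alpha> ` e) = 2"
      using permutes_image[OF assms] card_image[OF inj_on_subset[OF inj]]
      by (auto simp: pairs_def)
    with \<open>e \<in> pairs n\<close> show "pair_perm n \<alpha> e \<in> pairs n"
      by (auto simp: pair_perm_def pairs_def)
  qed
  moreover have "inj_on (pair_perm n \<alpha>) (pairs n)"
    using inj by (auto simp: inj_on_def pair_perm_def inj_image_eq_iff)
  ultimately show "bij_betw (pair_perm n \<alpha>) (pairs n) (pairs n)"
    by (simp add: bij_betw_def endo_inj_surj finite_pairs)
qed (simp add: pair_perm_def)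

lemma F_perm_eq:
  assumes "\<alpha> permutes vertices n"
  shows "F_perm n \<alpha>
    = (\<Sum>E | E \<subseteq> pairs n \<and> pair_perm n \<alpha> ` E = E. monom 1 (\<Sum>e\<in>E. weight n e))"
proof -
  have fin: "finite (pair_cycles n \<alpha>)"
    by (rule finite_subset[of _ "Pow (pairs n)"]) (auto simp: pair_cycles_def finite_pairs)
  \<comment> \<open>With the summands swapped, \<open>prod_add\<close> expands over the sets
    \<open>S\<close> of cycles that contribute a monomial; the other cycles contribute factors
    1.\<close>
  have "F_perm n \<alpha> = (\<Prod>z\<in>pair_cycles n \<alpha>. monom 1 (cycle_weight n z) + 1)"
    by (simp add: F_perm_def add.commute)
  also have "\<dots> = (\<Sum>S\<in>Pow (pair_cycles n \<alpha>). \<Prod>z\<in>S. monom 1 (cycle_weight n z))"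
    by (subst prod_add[OF fin]) simp
  also have "\<dots> = (\<Sum>S\<in>Pow (pair_cycles n \<alpha>). monom 1 (\<Sum>e\<in>\<Union> S. weight n e))"
  proof (rule sum.cong[OF refl])
    fix S assume "S \<in> Pow (pair_cycles n \<alpha>)"
    then have cyclic: "cyclic_on (pair_perm n \<alpha>) z" if "z \<in> S" for z
      using that by (auto simp: pair_cycles_def)
    \<comment> \<open>Cycles are finite and pairwise disjoint, so the weights over
      \<open>\<Union> S\<close> add up cycle by cycle.\<close>
    have "\<forall>z\<in>S. finite z" "\<forall>y\<in>S. \<forall>z\<in>S. y \<noteq> z \<longrightarrow> y \<inter> z = {}"
      using finite_cyclic_on[OF cyclic] cyclic_on_disjoint[OF cyclic cyclic] by auto
    then show "(\<Prod>z\<in>S. monom (1::nat) (cycle_weight n z)) = monom 1 (\<Sum>e\<in>\<Union> S. weight n e)"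
      unfolding prod_monom_1 cycle_weight_def by (simp add: sum.Union_disjoint)
  qed
  also have "\<dots> = (\<Sum>E | E \<subseteq> pairs n \<and> pair_perm n \<alpha> ` E = E. monom 1 (\<Sum>e\<in>E. weight n e))"
    unfolding pair_cycles_def
    by (rule sum.reindex_bij_betw[OF
          bij_betw_Union_cyclic_sets[OF pair_perm_permutes[OF assms] finite_pairs]])
  finally show ?thesis .
qed

text \<open>Every edge has the form \<open>{i, j}\<close>, so the comprehension in
  \<open>act\<close> reaches all of \<open>E\<close>. This turns membership in \<open>Aut\<close>
  into invariance under \<open>pair_perm\<close>.\<close>

lemma act_eq:
  assumes "E \<subseteq> pairs n"
  shows "act \<alpha> (vertices n, E) = (vertices n, pair_perm n \<alpha> ` E)"
proof -
  have "\<exists>i j. e = {i, j}" if "e \<in> E" for e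
  proof -
    have "card e = 2" using that assms by (auto simp: pairs_def)
    then show ?thesis by (auto simp: card_2_iff)
  qed
  then have "{{\<alpha> i, \<alpha> j} | i j. {i, j} \<in> E} = (`) \<alpha> ` E"
    by (auto simp: image_iff) (metis image_empty image_insert)+
  also have "\<dots> = pair_perm n \<alpha> ` E"
    using assms by (intro image_cong) (auto simp: pair_perm_def)
  finally show ?thesis by (simp add: act_def)
qed

text \<open>Double counting of the pairs of a vertex permutation and an edge set preserved by
  it.\<close>

lemma F_poly_eq:
  "F_poly n
    = (\<Sum>E\<in>Pow (pairs n). monom (card (Aut (vertices n, E))) (\<Sum>e\<in>E. weight n e))"
proof -
  let ?A = "{\<alpha>. \<alpha> permutes vertices n}" and ?m = "\<lambda>E. monom (1::nat) (\<Sum>e\<in>E. weight n e)"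
  have fin: "finite ?A" by (simp add: finite_permutations vertices_def)
  have "F_poly n = (\<Sum>\<alpha>\<in>?A. \<Sum>E | E \<in> Pow (pairs n) \<and> pair_perm n \<alpha> ` E = E. ?m E)"
    by (simp add: F_poly_def F_perm_eq)
  also have "\<dots> = (\<Sum>E\<in>Pow (pairs n). \<Sum>\<alpha> | \<alpha> \<in> ?A \<and> pair_perm n \<alpha> ` E = E. ?m E)"
    by (intro sum.swap_restrict fin) (simp add: finite_pairs)
  \<comment> \<open>The inner summand does not depend on \<alpha>, and by \<open>act_eq\<close> the
    inner index set is \<open>Aut (vertices n, E)\<close>.\<close>
  also have "\<dots> = (\<Sum>E\<in>Pow (pairs n). monom (card (Aut (vertices n, E))) (\<Sum>e\<in>E. weight n e))"
    by (intro sum.cong) (simp_all add: Aut_def act_eq of_nat_monom mult_monom)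
  finally show ?thesis .
qed

section \<open>Lexicographic positions and binary weights\<close>

text \<open>For 1 \<le> i \<le> n, the number of pairs whose smaller element is below i, that is,
  the last position before the block of pairs with minimum i.\<close>

definition row_offset :: "nat \<Rightarrow> nat \<Rightarrow> nat" where
  "row_offset n i = (2 * n - i) * (i - 1) div 2"

lemma row_offset_Suc:
  assumes "1 \<le> i" "i \<le> n"
  shows "row_offset n (Suc i) = row_offset n i + (n - i)"
proof -
  \<comment> \<open>The substitution removes the truncated subtractions; the identity is shown
    before halving, with \<open>n - i\<close> doubled.\<close>
  obtain k d where "i = Suc k" "n = Suc k + d"
    using assms by (metis Suc_pred' add.commute le_add_diff_inverse2 less_eq_Suc_le One_nat_def)
  then have "(2 * n - Suc i) * (Suc i - 1) = (2 * n - i) * (i - 1) + (n - i) * 2"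
    by (simp add: algebra_simps)
  then show ?thesis
    by (simp only: row_offset_def) simp
qed

lemma row_offset_mono:
  assumes "1 \<le> i" "i \<le> k" "k \<le> n"
  shows "row_offset n i \<le> row_offset n k"
  using assms(2,3)
proof (induct k rule: dec_induct)
  case (step m)
  with assms(1) show ?case by (simp add: row_offset_Suc)
qed simp

text \<open>A pair sits at offset \<open>j - i\<close> in its block, between 1 and the block length
  \<open>n - i\<close>.\<close>

lemma position_bounds:
  assumes "1 \<le> i" "i < j" "j \<le> n"
  shows "row_offset n i < position n i j" "position n i j \<le> row_offset n (Suc i)"
  using assms row_offset_Suc[of i n]
  unfolding position_def row_offset_def[of n i, symmetric] by linarith+

text \<open>The blocks of different minima follow one another without overlap.\<close>

lemma position_less:
  assumes "1 \<le> i" "i < j" "j \<le> n" "i < k" "k < l" "l \<le> n"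
  shows "position n i j < position n k l"
proof -
  have "position n i j \<le> row_offset n (Suc i)" using assms by (intro position_bounds)
  also have "\<dots> \<le> row_offset n k" using assms by (intro row_offset_mono) auto
  also have "\<dots> < position n k l" using assms by (intro position_bounds) auto
  finally show ?thesis .
qed

text \<open>Ensures that the subtraction in \<open>weight\<close> does not truncate. All blocks end
  by \<open>row_offset n n\<close>, which is n(n-1)/2.\<close>

lemma position_le_choose_two:
  assumes "1 \<le> i" "i < j" "j \<le> n"
  shows "position n i j \<le> n choose 2"
proof -
  have "position n i j \<le> row_offset n (Suc i)" using assms by (rule position_bounds)
  also have "\<dots> \<le> row_offset n n" using assms by (intro row_offset_mono) auto
  also have "\<dots> = n choose 2" by (simp add: row_offset_def choose_two)
  finally show ?thesis .
qed

lemma pairs_cases: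
  assumes "e \<in> pairs n"
  obtains i j where "e = {i, j}" "1 \<le> i" "i < j" "j \<le> n" "Min e = i" "Max e = j"
proof -
  obtain a b where "e = {a, b}" "a \<noteq> b" "a \<in> {1..n}" "b \<in> {1..n}"
    using assms by (auto simp: pairs_def vertices_def card_2_iff)
  then show thesis
    by (cases a b rule: linorder_cases) (auto intro: that[of a b] that[of b a])
qed

lemma inj_on_weight_exponent:
  "inj_on (\<lambda>e. (n choose 2) - position n (Min e) (Max e)) (pairs n)"
proof (rule inj_onI)
  fix d e
  assume d: "d \<in> pairs n" and e: "e \<in> pairs n"
    and eq: "(n choose 2) - position n (Min d) (Max d) = (n choose 2) - position n (Min e) (Max e)"
  obtain i j where ij: "d = {i, j}" "1 \<le> i" "i < j" "j \<le> n" "Min d = i" "Max d = j"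
    using d by (rule pairs_cases)
  obtain k l where kl: "e = {k, l}" "1 \<le> k" "k < l" "l \<le> n" "Min e = k" "Max e = l"
    using e by (rule pairs_cases)
  have pos: "position n i j = position n k l"
    using eq ij kl position_le_choose_two[of i j n] position_le_choose_two[of k l n] by simp
  \<comment> \<open>Different minima would put the pairs into different blocks; with equal minima
    the offset in the block determines the maximum.\<close>
  have "i = k"
    using pos ij kl position_less[of i j n k l] position_less[of k l n i j]
    by (cases i k rule: linorder_cases) simp_all
  moreover from this have "j = l"
    using pos ij kl by (simp add: position_def)
  ultimately show "d = e" using ij kl by simp
qed

lemma inj_on_sum_weight: "inj_on (\<lambda>E. \<Sum>e\<in>E. weight n e) (Pow (pairs n))"
proof -
  let ?x = "\<lambda>e. (n choose 2) - position n (Min e) (Max e)"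
  \<comment> \<open>\<open>set_encode\<close> reads a finite set as the places of the binary digits
    1, hence is injective on finite sets. The exponents are distinct, so the total weight is such an
    encoding.\<close>
  have "(\<Sum>e\<in>E. weight n e) = set_encode (?x ` E)" if "E \<subseteq> pairs n" for E
    using inj_on_subset[OF inj_on_weight_exponent that]
    by (simp add: set_encode_def weight_def sum.reindex)
  then have "D = E" if "D \<subseteq> pairs n" "E \<subseteq> pairs n"
    "(\<Sum>e\<in>D. weight n e) = (\<Sum>e\<in>E. weight n e)" for D E
    using that finite_subset[OF _ finite_pairs, of _ n]
      inj_on_image_eq_iff[OF inj_on_weight_exponent, of D n E]
    by (simp add: set_encode_eq)
  then show ?thesis
    by (intro inj_onI) simp
qed

section \<open>Coefficients and the count of graphs\<close>

lemma coeff_F_poly: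
  "coeff (F_poly n) L
    = (\<Sum>E | E \<subseteq> pairs n \<and> (\<Sum>e\<in>E. weight n e) = L. card (Aut (vertices n, E)))"
proof -
  have "coeff (F_poly n) L = (\<Sum>E\<in>Pow (pairs n).
      if (\<Sum>e\<in>E. weight n e) = L then card (Aut (vertices n, E)) else 0)"
    by (simp add: F_poly_eq coeff_sum)
  also have "\<dots> = (\<Sum>E | E \<in> Pow (pairs n) \<and> (\<Sum>e\<in>E. weight n e) = L.
      card (Aut (vertices n, E)))"
    by (simp add: sum.If_cases finite_pairs Int_def)
  finally show ?thesis by simp
qed

text \<open>By \<open>inj_on_sum_weight\<close> the sum in \<open>coeff_F_poly\<close> has a single
  term.\<close>

lemma coeff_F_poly_sum_weight:
  assumes "E \<subseteq> pairs n"
  shows "coeff (F_poly n) (\<Sum>e\<in>E. weight n e) = card (Aut (vertices n, E))"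
proof -
  have "{E'. E' \<subseteq> pairs n \<and> (\<Sum>e\<in>E'. weight n e) = (\<Sum>e\<in>E. weight n e)} = {E}"
    using assms inj_on_sum_weight[of n] by (auto simp: inj_on_def)
  then show ?thesis by (simp add: coeff_F_poly)
qed

text \<open>A nonzero coefficient makes the sum in \<open>coeff_F_poly\<close> nonempty, which
  supplies \<open>E\<close>. The value 0 is excluded because it occurs at the infinitely many
  exponents that are no total weight.\<close>

lemma level_set_eq:
  assumes "\<xi> \<noteq> 0"
  shows "level_set n \<xi>
    = (\<lambda>E. \<Sum>e\<in>E. weight n e) ` {E. E \<subseteq> pairs n \<and> card (Aut (vertices n, E)) = \<xi>}"
proof (intro equalityI subsetI)
  fix L assume "L \<in> level_set n \<xi>"
  then have L: "coeff (F_poly n) L = \<xi>" by (simp add: level_set_def)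
  with assms obtain E where E: "E \<subseteq> pairs n" "(\<Sum>e\<in>E. weight n e) = L"
    unfolding coeff_F_poly
    by (metis (mono_tags, lifting) mem_Collect_eq sum.not_neutral_contains_not_neutral)
  with L have "card (Aut (vertices n, E)) = \<xi>"
    using coeff_F_poly_sum_weight by metis
  with E show "L \<in> (\<lambda>E. \<Sum>e\<in>E. weight n e) ` {E. E \<subseteq> pairs n \<and> card (Aut (vertices n, E)) = \<xi>}"
    by blast
qed (auto simp: level_set_def coeff_F_poly_sum_weight)

theorem theorem6:
  fixes n \<xi> :: nat
  assumes "n \<ge> 3" and "\<xi> \<in> coeff_set n"
  shows "lg n \<xi> = card (level_set n \<xi>)"
proof -
  let ?X = "{E. E \<subseteq> pairs n \<and> card (Aut (vertices n, E)) = \<xi>}"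
  have "\<xi> \<noteq> 0" using assms(2) by (auto simp: coeff_set_def)
  then have "card (level_set n \<xi>) = card ?X"
    unfolding level_set_eq[OF \<open>\<xi> \<noteq> 0\<close>]
    by (intro card_image inj_on_subset[OF inj_on_sum_weight]) auto
  \<comment> \<open>The vertex set is fixed, so a graph is determined by its edge set.\<close>
  also have "\<dots> = card (Pair (vertices n) ` ?X)"
    by (simp add: card_image inj_on_def)
  also have "Pair (vertices n) ` ?X = {G \<in> labelled_graphs n. card (Aut G) = \<xi>}"
    by (auto simp: labelled_graphs_def)
  finally show ?thesis by (simp add: lg_def)
qed

end
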